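(* Let $f,g$ be $\omega$-braids. Then $f\sim g$ if and only if $f|_n\sim g|_n$ for every $n\in\omega$.
   Context: $\omega=\{0,1,2,\dots\}\subset\mathbb{C}$ is the set of non-negative integers, and each $n\in\omega$ is identified with the set $\{0,\dots,n-1\}$ ($0$ is the empty set). Let $\mathbb{I}=[0,1]$. For $X\subset\mathbb{C}$, $\mathbb{C}^X$ is the product space (product topology) and $F_X=\{u\in\mathbb{C}^X : u(x)\neq u(y)\text{ for all distinct }x,y\in X\}$ with the subspace topology. A path in a space is a continuous map from $\mathbb{I}$; $f\sim g$ means that the paths $f,g$ are homotopic in the space in question relative to $\{0,1\}$. $\Sigma_X$ is the set of all permutations of $X$; since $X\subset\mathbb{C}$, $\Sigma_X\subset F_X$. An $X$-braid is a path $f:\mathbb{I}\to F_X$ with $f(0)=\mathrm{id}_X$ and $f(1)\in\Sigma_X$; an $\omega$-braid is the case $X=\omega$. For a path $f$ in $F_X$ and $Y\subset X$, the restriction $f|_Y$ is the path in $F_Y$ given by $f|_Y(t)(y)=f(t)(y)$ for $y\in Y$ (for an $\omega$-braid $f$, $f|_n$ is a path in $F_n$ and need not be an $n$-braid). *)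

theory Defs
  imports "HOL-Analysis.Analysis"
begin

(* A point of C^X is an extensional function complex => complex, so that the product is
   the library's product_topology on the carrier X \<rightarrow>\<^sub>E UNIV.  In particular C^{} has exactly
   one point. *)
definition config_space :: "complex set \<Rightarrow> (complex \<Rightarrow> complex) topology" where
  "config_space X = subtopology (product_topology (\<lambda>x. euclidean) X) {u. inj_on u X}"

definition permutations_of_set_ext :: "complex set \<Rightarrow> (complex \<Rightarrow> complex) set" where
  "permutations_of_set_ext X = {u \<in> extensional X. bij_betw u X X}"

(* As with pathin, only the values of a path on {0..1} matter. *)
definition is_braid :: "complex set \<Rightarrow> (real \<Rightarrow> complex \<Rightarrow> complex) \<Rightarrow> bool" where
  "is_braid X f \<longleftrightarrow>
     pathin (config_space X) f \<and> f 0 = restrict id X \<and> f 1 \<in> permutations_of_set_ext X"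

(* Homotopy of paths relative to the endpoints, in an abstract topology; for the Euclidean
   subspace topologies this is the library's homotopic_paths. *)
definition path_homotopic :: "'a topology \<Rightarrow> (real \<Rightarrow> 'a) \<Rightarrow> (real \<Rightarrow> 'a) \<Rightarrow> bool" where
  "path_homotopic T f g \<longleftrightarrow>
     homotopic_with (\<lambda>h. h 0 = f 0 \<and> h 1 = f 1) (top_of_set {0..1}) T f g"

definition path_restrict :: "(real \<Rightarrow> complex \<Rightarrow> complex) \<Rightarrow> complex set \<Rightarrow> real \<Rightarrow> complex \<Rightarrow> complex" where
  "path_restrict f Y = (\<lambda>t. restrict (f t) Y)"

abbreviation omega :: "complex set" where
  "omega \<equiv> \<nat>"

(* The von Neumann natural n = {0,...,n-1}, as a subset of the complex plane. *)
definition initial_segment :: "nat \<Rightarrow> complex set" where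
  "initial_segment n = of_nat ` {..<n}"

end

theory Submission
  imports Defs
begin

text \<open>
  One implication is restriction of a homotopy. For the other, a homotopy from \<open>f\<close> to \<open>g\<close> in
  \<open>F\<^sub>\<omega>\<close> is a sequence of maps \<open>h\<^sub>0, h\<^sub>1, \<dots>\<close> from the square to the plane, pairwise distinct at
  every point of the square, with prescribed values on its rim. The hypothesis provides such
  sequences of every finite length, but those of different lengths need not agree where they
  overlap. So the sequence is built one coordinate at a time, and the whole point is that a partial
  sequence \<open>H = (h\<^sub>0, \<dots>, h\<^sub>n\<^sub>-\<^sub>1)\<close> can always be prolonged by one more coordinate.

  What is known is another square \<open>P\<close> in \<open>F\<^sub>n\<close> with the same rim as \<open>H\<close> and a further coordinate
  \<open>k\<close> that avoids \<open>P\<close>; what is wanted is a coordinate that avoids \<open>H\<close> and agrees with \<open>k\<close> on the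
  rim. In general \<open>P\<close> and \<open>H\<close> form a sphere in \<open>F\<^sub>n\<close>, which could obstruct this. One could show
  that \<open>\<pi>\<^sub>2(F\<^sub>n)\<close> vanishes, but it is enough that the projection \<open>F\<^sub>n\<^sub>+\<^sub>1 \<rightarrow> F\<^sub>n\<close> has a global
  section: a new point can be put far away from the \<open>n\<close> given ones. Slide \<open>k\<close> over the constant
  homotopy of \<open>P\<close> to the section over \<open>P\<close>, and record the trace of this motion over the rim. Since
  \<open>H = P\<close> on the rim, the trace read backwards starts at the section over \<open>H\<close>, and following it
  from there yields a coordinate over \<open>H\<close> with the rim values of \<open>k\<close>. This is \<open>relift_square\<close>.

  Both motions are instances of the homotopy lifting property of \<open>F\<^sub>n\<^sub>+\<^sub>1 \<rightarrow> F\<^sub>n\<close>, relative to a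
  retract (\<open>extend_avoiding\<close>): an extra point over a retract of a compact convex set extends to the
  whole set. It rests on an explicit formula, \<open>drag\<close>, which moves the extra point out of the way
  when the \<open>n\<close> points move a little.
\<close>

section \<open>Dragging an extra point along with moving points\<close>

text \<open>
  The weights are tents of height 1 and radius \<open>r\<close> around the \<open>p i\<close>. If the \<open>p i\<close> are at least \<open>r\<close>
  apart, each tent vanishes at the other points, so that \<open>p i\<close> is sent exactly to \<open>q i\<close>.
\<close>

definition drag :: "nat \<Rightarrow> real \<Rightarrow> (nat \<Rightarrow> 'a) \<Rightarrow> (nat \<Rightarrow> 'a) \<Rightarrow> 'a \<Rightarrow> 'a::real_normed_vector" where
  "drag n r p q z = z + (\<Sum>i<n. max 0 (1 - norm (z - p i) / r) *\<^sub>R (q i - p i))"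

lemma drag_eq_self:
  assumes "\<And>i. i < n \<Longrightarrow> q i = p i"
  shows "drag n r p q z = z"
  unfolding drag_def using assms by simp

lemma drag_moves_points:
  assumes "r > 0" "i < n" and sep: "\<And>j. \<lbrakk>j < n; j \<noteq> i\<rbrakk> \<Longrightarrow> r \<le> norm (p i - p j)"
  shows "drag n r p q (p i) = q i"
proof -
  have "(\<Sum>j<n. max 0 (1 - norm (p i - p j) / r) *\<^sub>R (q j - p j))
      = (\<Sum>j<n. if j = i then q j - p j else 0)"
  proof (intro sum.cong refl)
    fix j assume "j \<in> {..<n}"
    show "max 0 (1 - norm (p i - p j) / r) *\<^sub>R (q j - p j) = (if j = i then q j - p j else 0)"
    proof (cases "j = i")
      case False
      then have "1 - norm (p i - p j) / r \<le> 0"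
        using sep[of j] \<open>j \<in> {..<n}\<close> \<open>r > 0\<close> by simp
      then show ?thesis
        using False by simp
    qed simp
  qed
  also have "\<dots> = q i - p i"
    using \<open>i < n\<close> by simp
  finally show ?thesis
    by (simp add: drag_def)
qed

text \<open>
  The tents are Lipschitz with constant \<open>1/r\<close>, so the total displacement is Lipschitz with
  constant at most 1/2: the map is a perturbation of the identity by a contraction. The bound uses
  \<open>n + 1\<close> rather than \<open>n\<close> so that it is positive for \<open>n = 0\<close> too.
\<close>
lemma drag_injective:
  assumes "r > 0" and small: "\<And>i. i < n \<Longrightarrow> norm (q i - p i) \<le> r / (2 * real (Suc n))"
    and eq: "drag n r p q z = drag n r p q w"
  shows "z = w"
proof -
  let ?b = "\<lambda>z i. max 0 (1 - norm (z - p i) / r)"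
  have "z - w = (\<Sum>i<n. ?b w i *\<^sub>R (q i - p i)) - (\<Sum>i<n. ?b z i *\<^sub>R (q i - p i))"
    using eq unfolding drag_def by (simp add: algebra_simps)
  then have "norm (z - w) = norm (\<Sum>i<n. (?b w i - ?b z i) *\<^sub>R (q i - p i))"
    by (simp only: scaleR_diff_left sum_subtractf)
  also have "\<dots> \<le> (\<Sum>i<n. norm (z - w) / r * (r / (2 * real (Suc n))))"
  proof (rule sum_norm_le)
    fix i assume "i \<in> {..<n}"
    have "\<bar>?b w i - ?b z i\<bar> \<le> \<bar>norm (z - p i) / r - norm (w - p i) / r\<bar>"
      by (auto simp: max_def)
    also have "\<dots> = \<bar>norm (z - p i) - norm (w - p i)\<bar> / r"
      using \<open>r > 0\<close> by (simp add: diff_divide_distrib[symmetric])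
    also have "\<dots> \<le> norm (z - w) / r"
      using norm_triangle_ineq3[of "z - p i" "w - p i"] \<open>r > 0\<close> by (simp add: divide_right_mono)
    finally have "\<bar>?b w i - ?b z i\<bar> \<le> norm (z - w) / r" .
    then show "norm ((?b w i - ?b z i) *\<^sub>R (q i - p i)) \<le> norm (z - w) / r * (r / (2 * real (Suc n)))"
      using small[of i] \<open>i \<in> {..<n}\<close> \<open>r > 0\<close>
      unfolding norm_scaleR by (intro mult_mono) auto
  qed
  also have "\<dots> = norm (z - w) * (real n / (2 * real (Suc n)))"
    using \<open>r > 0\<close> by simp
  also have "\<dots> \<le> norm (z - w) * (1/2)"
    by (intro mult_left_mono) (auto simp: field_simps)
  finally show ?thesis by simp
qed

lemma continuous_on_drag [continuous_intros]:
  assumes "\<And>i. i < n \<Longrightarrow> continuous_on S (\<lambda>x. p x i)" "\<And>i. i < n \<Longrightarrow> continuous_on S (\<lambda>x. q x i)"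
    and "continuous_on S u" "r \<noteq> 0"
  shows "continuous_on S (\<lambda>x. drag n r (p x) (q x) (u x))"
  unfolding drag_def using assms by (auto intro!: continuous_intros)

lemma uniformly_separated:
  fixes P :: "nat \<Rightarrow> 'x::metric_space \<Rightarrow> 'a::real_normed_vector"
  assumes "compact S" and cont: "\<And>i. i < n \<Longrightarrow> continuous_on S (P i)"
    and dist: "\<And>i j x. \<lbrakk>i < n; j < n; i \<noteq> j; x \<in> S\<rbrakk> \<Longrightarrow> P i x \<noteq> P j x"
  obtains r where "r > 0" "\<And>i j x. \<lbrakk>i < n; j < n; i \<noteq> j; x \<in> S\<rbrakk> \<Longrightarrow> r \<le> norm (P i x - P j x)"
proof -
  let ?I = "{(i,j). i < n \<and> j < n \<and> i \<noteq> j}"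
  have "\<exists>d>0. \<forall>x\<in>S. d \<le> norm (P (fst ij) x - P (snd ij) x)" if "ij \<in> ?I" for ij
  proof (cases "S = {}")
    case False
    obtain i j where ij: "ij = (i, j)" "i < n" "j < n" "i \<noteq> j"
      using \<open>ij \<in> ?I\<close> by auto
    have "continuous_on S (\<lambda>x. norm (P i x - P j x))"
      using cont ij by (intro continuous_intros) auto
    from continuous_attains_inf[OF \<open>compact S\<close> False this]
    obtain x0 where "x0 \<in> S" and min: "\<forall>x\<in>S. norm (P i x0 - P j x0) \<le> norm (P i x - P j x)"
      by blast
    have "norm (P i x0 - P j x0) > 0"
      using dist[OF ij(2-4) \<open>x0 \<in> S\<close>] by simp
    with min show ?thesis
      unfolding ij(1) fst_conv snd_conv by blast
  next
    case True
    then show ?thesis by (intro exI[of _ 1]) simp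
  qed
  then have "\<exists>d. \<forall>ij\<in>?I. d ij > 0 \<and> (\<forall>x\<in>S. d ij \<le> norm (P (fst ij) x - P (snd ij) x))"
    by (intro bchoice ballI)
  then obtain d where "\<forall>ij\<in>?I. d ij > 0 \<and> (\<forall>x\<in>S. d ij \<le> norm (P (fst ij) x - P (snd ij) x))" ..
  then have d: "\<And>ij. ij \<in> ?I \<Longrightarrow> d ij > 0"
    "\<And>ij x. \<lbrakk>ij \<in> ?I; x \<in> S\<rbrakk> \<Longrightarrow> d ij \<le> norm (P (fst ij) x - P (snd ij) x)"
    by blast+
  have fin: "finite (insert 1 (d ` ?I))"
    by (intro finite.insertI finite_imageI, rule finite_subset[of _ "{..<n} \<times> {..<n}"]) auto
  show thesis
  proof (rule that[of "Min (insert 1 (d ` ?I))"])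
    show "Min (insert 1 (d ` ?I)) > 0"
      using d(1) by (subst Min_gr_iff[OF fin]) auto
    show "Min (insert 1 (d ` ?I)) \<le> norm (P i x - P j x)" if "i < n" "j < n" "i \<noteq> j" "x \<in> S" for i j x
    proof -
      have ij: "(i, j) \<in> ?I"
        using that by simp
      then have "Min (insert 1 (d ` ?I)) \<le> d (i, j)"
        by (intro Min_le[OF fin]) blast
      also have "\<dots> \<le> norm (P i x - P j x)"
        using d(2)[OF ij \<open>x \<in> S\<close>] by simp
      finally show ?thesis .
    qed
  qed
qed

lemma equicontinuous_finite_family:
  fixes P :: "nat \<Rightarrow> 'x::metric_space \<Rightarrow> 'a::metric_space"
  assumes "compact S" "\<And>i. i < n \<Longrightarrow> continuous_on S (P i)" "e > 0"
  obtains d where "d > 0"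
    "\<And>i x y. \<lbrakk>i < n; x \<in> S; y \<in> S; dist x y < d\<rbrakk> \<Longrightarrow> dist (P i x) (P i y) < e"
proof -
  have "\<exists>d>0. \<forall>i<n. \<forall>x\<in>S. \<forall>y\<in>S. dist x y < d \<longrightarrow> dist (P i x) (P i y) < e"
    using assms(2)
  proof (induction n)
    case (Suc n)
    then obtain d where d: "d > 0" "\<forall>i<n. \<forall>x\<in>S. \<forall>y\<in>S. dist x y < d \<longrightarrow> dist (P i x) (P i y) < e"
      by auto
    have "uniformly_continuous_on S (P n)"
      using Suc.prems assms(1) by (simp add: compact_uniformly_continuous)
    then obtain d' where "d' > 0" "\<forall>x\<in>S. \<forall>y\<in>S. dist x y < d' \<longrightarrow> dist (P n x) (P n y) < e"
      using \<open>e > 0\<close> unfolding uniformly_continuous_on_def by (metis dist_commute)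
    then show ?case
      using d by (intro exI[of _ "min d d'"]) (auto simp: less_Suc_eq)
  next
    case 0
    then show ?case by (intro exI[of _ 1]) simp
  qed
  then obtain d where "d > 0"
    "\<forall>i<n. \<forall>x\<in>S. \<forall>y\<in>S. dist x y < d \<longrightarrow> dist (P i x) (P i y) < e"
    by blast
  then show thesis
    by (intro that[of d]) simp_all
qed

section \<open>Lifting homotopies of configurations\<close>

text \<open>
  By compactness the points stay at distance at least some \<open>r\<close> from one another, and \<open>[0,1]\<close> splits
  into equal steps during which each of them moves so little that \<open>drag\<close> is injective. On each step
  the extra point is dragged along from where the previous step left it; injectivity keeps it off
  the other points. As \<open>drag\<close> is the identity when nothing moves, the lift stays constant wherever
  the configuration does. This last property is what makes lifting relative to a subset possible.
\<close>
lemma homotopy_lifting: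
  fixes G :: "nat \<Rightarrow> 'x::metric_space \<times> real \<Rightarrow> 'a::real_normed_vector"
  assumes "compact X" and contG: "\<And>i. i < n \<Longrightarrow> continuous_on (X \<times> {0..1}) (G i)"
    and distG: "\<And>i j y. \<lbrakk>i < n; j < n; i \<noteq> j; y \<in> X \<times> {0..1}\<rbrakk> \<Longrightarrow> G i y \<noteq> G j y"
    and cont0: "continuous_on X u0"
    and avoid0: "\<And>i x. \<lbrakk>i < n; x \<in> X\<rbrakk> \<Longrightarrow> u0 x \<noteq> G i (x, 0)"
  obtains u where "continuous_on (X \<times> {0..1}) u"
    "\<And>i y. \<lbrakk>i < n; y \<in> X \<times> {0..1}\<rbrakk> \<Longrightarrow> u y \<noteq> G i y"
    "\<And>x. x \<in> X \<Longrightarrow> u (x, 0) = u0 x"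
    "\<And>x t. \<lbrakk>x \<in> X; t \<in> {0..1}; \<And>i s. \<lbrakk>i < n; s \<in> {0..1}\<rbrakk> \<Longrightarrow> G i (x, s) = G i (x, 0)\<rbrakk> \<Longrightarrow> u (x, t) = u0 x"
proof -
  have comp: "compact (X \<times> {0..1::real})"
    using \<open>compact X\<close> by (intro compact_Times) auto
  obtain r where "r > 0"
    and sep: "\<And>i j y. \<lbrakk>i < n; j < n; i \<noteq> j; y \<in> X \<times> {0..1}\<rbrakk> \<Longrightarrow> r \<le> norm (G i y - G j y)"
    by (rule uniformly_separated[OF comp, of n G]) (use contG distG in blast)+
  have r': "r / (2 * real (Suc n)) > 0"
    using \<open>r > 0\<close> by simp
  obtain d where "d > 0"
    and d: "\<And>i x y. \<lbrakk>i < n; x \<in> X \<times> {0..1}; y \<in> X \<times> {0..1}; dist x y < d\<rbrakk>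
              \<Longrightarrow> dist (G i x) (G i y) < r / (2 * real (Suc n))"
    by (rule equicontinuous_finite_family[OF comp _ r', of n G]) (use contG in blast)+
  obtain N where N: "N > 0" "1 / real N < d"
    using nat_approx_posE[OF \<open>d > 0\<close>] by (metis zero_less_Suc)
  have "\<exists>u. continuous_on (X \<times> {0..real k / N}) u
      \<and> (\<forall>i<n. \<forall>y\<in>X \<times> {0..real k / N}. u y \<noteq> G i y)
      \<and> (\<forall>x\<in>X. u (x, 0) = u0 x)
      \<and> (\<forall>x\<in>X. \<forall>t\<in>{0..real k / N}. (\<forall>i<n. \<forall>s\<in>{0..1}. G i (x, s) = G i (x, 0)) \<longrightarrow> u (x, t) = u0 x)"
    if "k \<le> N" for k
    using that
  proof (induction k)
    case 0
    have "continuous_on (X \<times> {0..0::real}) (\<lambda>y. u0 (fst y))"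
      by (intro continuous_on_compose2[OF cont0] continuous_intros) auto
    then show ?case
      using avoid0 by (intro exI[of _ "\<lambda>y. u0 (fst y)"]) auto
  next
    case (Suc k)
    define a where "a = real k / N"
    define b where "b = real (Suc k) / N"
    have ab: "0 \<le> a" "a \<le> b" "b \<le> 1" "b - a < d"
      using Suc.prems N by (auto simp: a_def b_def field_simps)
    from Suc obtain u where u: "continuous_on (X \<times> {0..a}) u"
      "\<forall>i<n. \<forall>y\<in>X \<times> {0..a}. u y \<noteq> G i y"
      "\<forall>x\<in>X. u (x, 0) = u0 x"
      "\<forall>x\<in>X. \<forall>t\<in>{0..a}. (\<forall>i<n. \<forall>s\<in>{0..1}. G i (x, s) = G i (x, 0)) \<longrightarrow> u (x, t) = u0 x"
      by (auto simp: a_def)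
    define v where "v = (\<lambda>y. drag n r (\<lambda>i. G i (fst y, a)) (\<lambda>i. G i y) (u (fst y, a)))"
    define w where "w = (\<lambda>y. if snd y \<le> a then u y else v y)"
    have "continuous_on (X \<times> {a..b}) v"
      unfolding v_def using ab \<open>r > 0\<close>
      by (intro continuous_on_drag continuous_on_compose2[OF contG] continuous_on_compose2[OF u(1)]
            continuous_on_subset[OF contG] continuous_intros) auto
    then have "continuous_on {y \<in> X \<times> {0..b}. a \<le> snd y} v"
      by (rule continuous_on_subset) auto
    moreover have "continuous_on {y \<in> X \<times> {0..b}. snd y \<le> a} u"
      by (rule continuous_on_subset[OF u(1)]) auto
    moreover have "u y = v y" if "y \<in> X \<times> {0..b}" "snd y = a" for y
      using that by (cases y) (simp add: v_def drag_eq_self)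
    ultimately have contw: "continuous_on (X \<times> {0..b}) w"
      unfolding w_def by (intro continuous_on_cases_le continuous_intros) auto
    have "w y \<noteq> G i y" if "i < n" "y \<in> X \<times> {0..b}" for i y
    proof (cases "snd y \<le> a")
      case True
      then show ?thesis using that u(2) by (auto simp: w_def)
    next
      case False
      obtain x t where y: "y = (x, t)" by (cases y)
      have xt: "x \<in> X" "a \<le> t" "t \<le> b" "t \<in> {0..1}" "a \<in> {0..1}"
        using False that ab by (auto simp: y)
      let ?p = "\<lambda>i. G i (x, a)" and ?q = "\<lambda>i. G i (x, t)"
      have "norm (?q j - ?p j) \<le> r / (2 * real (Suc n))" if "j < n" for j
        using d[OF that, of "(x,t)" "(x,a)"] xt ab by (auto simp: dist_Pair_Pair dist_norm)
      moreover have "drag n r ?p ?q (?p i) = ?q i"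
        using drag_moves_points[OF \<open>r > 0\<close> \<open>i < n\<close>, of ?p ?q] sep[of i _ "(x,a)"] xt that by auto
      moreover have "u (x, a) \<noteq> ?p i"
        using u(2) that xt by auto
      ultimately have "drag n r ?p ?q (u (x, a)) \<noteq> ?q i"
        using drag_injective[OF \<open>r > 0\<close>, of n ?q ?p "u (x, a)" "?p i"] by auto
      then show ?thesis
        using False by (simp add: w_def v_def y)
    qed
    moreover have "w (x, t) = u0 x"
      if "x \<in> X" "t \<in> {0..b}" and const: "\<forall>i<n. \<forall>s\<in>{0..1}. G i (x, s) = G i (x, 0)" for x t
    proof (cases "t \<le> a")
      case True
      then have "t \<in> {0..a}"
        using \<open>t \<in> {0..b}\<close> by simp
      then have "u (x, t) = u0 x"
        using u(4) \<open>x \<in> X\<close> const by blast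
      then show ?thesis using True by (simp add: w_def)
    next
      case False
      have "G i (x, t) = G i (x, a)" if "i < n" for i
      proof -
        have "t \<in> {0..1}" "a \<in> {0..1}"
          using \<open>t \<in> {0..b}\<close> ab by auto
        then show ?thesis
          using const \<open>i < n\<close> by metis
      qed
      then have "v (x, t) = u (x, a)"
        unfolding v_def by (simp add: drag_eq_self)
      also have "\<dots> = u0 x"
      proof -
        have "a \<in> {0..a}"
          using ab by simp
        then show ?thesis
          using u(4) \<open>x \<in> X\<close> const by blast
      qed
      finally show ?thesis using False by (simp add: w_def)
    qed
    moreover have "w (x, 0) = u0 x" if "x \<in> X" for x
      using u(3) that ab by (simp add: w_def)
    ultimately show ?case
      unfolding b_def[symmetric] using contw by blast
  qed
  from this[of N] obtain u where u: "continuous_on (X \<times> {0..1}) u"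
      "\<forall>i<n. \<forall>y\<in>X \<times> {0..1}. u y \<noteq> G i y"
      "\<forall>x\<in>X. u (x, 0) = u0 x"
      "\<forall>x\<in>X. \<forall>t\<in>{0..1}. (\<forall>i<n. \<forall>s\<in>{0..1}. G i (x, s) = G i (x, 0)) \<longrightarrow> u (x, t) = u0 x"
    using N(1) by auto
  show thesis
  proof (rule that[of u])
    show "continuous_on (X \<times> {0..1}) u"
      by (fact u(1))
    show "u y \<noteq> G i y" if "i < n" "y \<in> X \<times> {0..1}" for i y
      using u(2) that by blast
    show "u (x, 0) = u0 x" if "x \<in> X" for x
      using u(3) that by blast
    show "u (x, t) = u0 x"
      if "x \<in> X" "t \<in> {0..1}" "\<And>i s. \<lbrakk>i < n; s \<in> {0..1}\<rbrakk> \<Longrightarrow> G i (x, s) = G i (x, 0)" for x t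
    proof -
      have "\<forall>i<n. \<forall>s\<in>{0..1}. G i (x, s) = G i (x, 0)"
        by (intro allI impI ballI that(3))
      then show ?thesis
        using u(4) that(1,2) by blast
    qed
  qed
qed

text \<open>
  Contract \<open>Y\<close> to \<open>B\<close> along the segments from \<open>\<rho> y\<close> to \<open>y\<close>, where \<open>\<rho>\<close> is the retraction, and lift
  this homotopy starting from \<open>u \<circ> \<rho>\<close>. Over \<open>B\<close> the segments are constant, hence so is the lift,
  and its final values there are still those of \<open>u\<close>.
\<close>
lemma extend_avoiding:
  fixes P :: "nat \<Rightarrow> 'x::real_normed_vector \<Rightarrow> 'a::real_normed_vector"
  assumes "compact Y" "convex Y" and "B retract_of Y"
    and contP: "\<And>i. i < n \<Longrightarrow> continuous_on Y (P i)"
    and distP: "\<And>i j y. \<lbrakk>i < n; j < n; i \<noteq> j; y \<in> Y\<rbrakk> \<Longrightarrow> P i y \<noteq> P j y"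
    and contu: "continuous_on B u"
    and avoidu: "\<And>i y. \<lbrakk>i < n; y \<in> B\<rbrakk> \<Longrightarrow> u y \<noteq> P i y"
  obtains v where "continuous_on Y v" "\<And>i y. \<lbrakk>i < n; y \<in> Y\<rbrakk> \<Longrightarrow> v y \<noteq> P i y"
    "\<And>y. y \<in> B \<Longrightarrow> v y = u y"
proof -
  obtain \<rho> where \<rho>: "B \<subseteq> Y" "continuous_on Y \<rho>" "\<And>y. y \<in> Y \<Longrightarrow> \<rho> y \<in> B" "\<And>y. y \<in> B \<Longrightarrow> \<rho> y = y"
    using \<open>B retract_of Y\<close> unfolding retract_of_def retraction_def by blast
  define c where "c = (\<lambda>(y, t). (1 - t) *\<^sub>R \<rho> y + t *\<^sub>R y)"
  have contc: "continuous_on (Y \<times> {0..1}) c"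
    unfolding c_def case_prod_unfold
    by (intro continuous_intros continuous_on_compose2[OF \<rho>(2)]) auto
  have cY: "c x \<in> Y" if "x \<in> Y \<times> {0..1}" for x
  proof -
    obtain y t where x: "x = (y, t)" "y \<in> Y" "0 \<le> t" "t \<le> 1"
      using \<open>x \<in> Y \<times> {0..1}\<close> by auto
    moreover have "\<rho> y \<in> Y"
      using x \<rho>(1,3) by blast
    ultimately show ?thesis
      using \<open>convex Y\<close> by (simp add: c_def convex_alt)
  qed
  have cont0: "continuous_on Y (u \<circ> \<rho>)"
    using \<rho> by (intro continuous_on_compose continuous_on_subset[OF contu]) auto
  have c0: "c (y, 0) = \<rho> y" and c1: "c (y, 1) = y" for y
    by (simp_all add: c_def)
  have cB: "c (y, t) = y" if "y \<in> B" for y t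
    using \<rho>(4)[OF that] by (simp add: c_def scaleR_left_distrib[symmetric])
  have contPc: "continuous_on (Y \<times> {0..1}) (P i \<circ> c)" if "i < n" for i
    using cY by (intro continuous_on_compose contc continuous_on_subset[OF contP[OF that]]) auto
  have distPc: "(P i \<circ> c) y \<noteq> (P j \<circ> c) y"
    if "i < n" "j < n" "i \<noteq> j" "y \<in> Y \<times> {0..1}" for i j y
    using distP[OF that(1-3)] cY[OF that(4)] by simp
  have avoid0: "(u \<circ> \<rho>) y \<noteq> (P i \<circ> c) (y, 0)" if "i < n" "y \<in> Y" for i y
    using avoidu[OF \<open>i < n\<close>] \<rho>(3)[OF that(2)] by (simp add: c0)
  show thesis
  proof (rule homotopy_lifting[of Y n "\<lambda>i. P i \<circ> c" "u \<circ> \<rho>"])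
    fix v
    assume v: "continuous_on (Y \<times> {0..1}) v"
      "\<And>i y. \<lbrakk>i < n; y \<in> Y \<times> {0..1}\<rbrakk> \<Longrightarrow> v y \<noteq> (P i \<circ> c) y"
      and const: "\<And>y t. \<lbrakk>y \<in> Y; t \<in> {0..1};
          \<And>i s. \<lbrakk>i < n; s \<in> {0..1}\<rbrakk> \<Longrightarrow> (P i \<circ> c) (y, s) = (P i \<circ> c) (y, 0)\<rbrakk>
        \<Longrightarrow> v (y, t) = (u \<circ> \<rho>) y"
    show thesis
    proof (rule that[of "\<lambda>y. v (y, 1)"])
      show "continuous_on Y (\<lambda>y. v (y, 1))"
        by (intro continuous_on_compose2[OF v(1)] continuous_intros) auto
      show "v (y, 1) \<noteq> P i y" if "i < n" "y \<in> Y" for i y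
        using v(2)[of i "(y, 1)"] that by (simp add: c1)
      show "v (y, 1) = u y" if "y \<in> B" for y
      proof -
        have "v (y, 1) = (u \<circ> \<rho>) y"
        proof (rule const)
          show "y \<in> Y"
            using \<open>y \<in> B\<close> \<rho>(1) by blast
          show "(P i \<circ> c) (y, s) = (P i \<circ> c) (y, 0)" for i s
            by (simp add: cB[OF \<open>y \<in> B\<close>])
        qed simp
        then show ?thesis
          using \<rho>(4)[OF that] by simp
      qed
    qed
  qed (fact \<open>compact Y\<close> contPc distPc cont0 avoid0)+
qed

section \<open>Retractions of the cube\<close>

text \<open>
  Think of \<open>N\<close> as the gauge of a convex body centred at \<open>c\<close>. The cylinder over the body is projected
  from the point \<open>(c, 2)\<close> above its top onto its bottom and its lateral boundary. Rays through
  points with \<open>N x + t/2 \<le> 1\<close> hit the bottom, the others the side.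
\<close>
lemma retraction_onto_bottom_and_sides:
  fixes N :: "'x::real_normed_vector \<Rightarrow> real"
  assumes contN: "continuous_on UNIV N"
    and homog: "\<And>a x. a \<ge> 0 \<Longrightarrow> N (c + a *\<^sub>R (x - c)) = a * N x"
  defines "Y \<equiv> {x. N x \<le> 1} \<times> {0..1::real}"
  shows "{y \<in> Y. snd y = 0 \<or> N (fst y) = 1} retract_of Y"
proof -
  define \<rho> where "\<rho> = (\<lambda>y. if N (fst y) + snd y / 2 \<le> 1
      then (c + (1 / (1 - snd y / 2)) *\<^sub>R (fst y - c), 0)
      else (c + (1 / N (fst y)) *\<^sub>R (fst y - c), 2 - (2 - snd y) / N (fst y)))"
  have contN': "continuous_on S (\<lambda>y::'x \<times> real. N (fst y))" for S
    by (intro continuous_on_compose2[OF contN] continuous_intros) auto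
  have "continuous_on Y \<rho>"
    unfolding \<rho>_def
  proof (rule continuous_on_cases_le)
    show "continuous_on {y \<in> Y. N (fst y) + snd y / 2 \<le> 1}
            (\<lambda>y. (c + (1 / (1 - snd y / 2)) *\<^sub>R (fst y - c), 0))"
      by (intro continuous_intros) (auto simp: Y_def)
    show "continuous_on {y \<in> Y. 1 \<le> N (fst y) + snd y / 2}
            (\<lambda>y. (c + (1 / N (fst y)) *\<^sub>R (fst y - c), 2 - (2 - snd y) / N (fst y)))"
      by (intro continuous_intros contN') (auto simp: Y_def)
    show "continuous_on Y (\<lambda>y. N (fst y) + snd y / 2)"
      by (intro continuous_intros contN') auto
    show "(c + (1 / (1 - snd y / 2)) *\<^sub>R (fst y - c), 0)
        = (c + (1 / N (fst y)) *\<^sub>R (fst y - c), 2 - (2 - snd y) / N (fst y))"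
      if "y \<in> Y" "N (fst y) + snd y / 2 = 1" for y
    proof -
      have N: "N (fst y) = 1 - snd y / 2" and "snd y \<le> 1"
        using that by (auto simp: Y_def)
      then show ?thesis
        unfolding N by (auto simp: field_simps)
    qed
  qed
  moreover have "\<rho> (x, t) \<in> {y \<in> Y. snd y = 0 \<or> N (fst y) = 1}" if "(x, t) \<in> Y" for x t
  proof -
    have xt: "0 \<le> t" "t \<le> 1" "N x \<le> 1"
      using that by (auto simp: Y_def)
    show ?thesis
    proof (cases "N x + t / 2 \<le> 1")
      case True
      have "N (c + (1 / (1 - t / 2)) *\<^sub>R (x - c)) = N x / (1 - t / 2)"
        using xt by (subst homog) auto
      also have "\<dots> \<le> 1"
        using True xt by (auto simp: field_simps)
      finally show ?thesis
        using True by (simp add: \<rho>_def Y_def)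
    next
      case False
      then have "N x > 0"
        using xt by auto
      then have "N (c + (1 / N x) *\<^sub>R (x - c)) = 1"
        by (subst homog) auto
      moreover have "0 \<le> 2 - (2 - t) / N x" "2 - (2 - t) / N x \<le> 1"
        using False xt \<open>N x > 0\<close> by (auto simp: field_simps)
      ultimately show ?thesis
        using False by (simp add: \<rho>_def Y_def)
    qed
  qed
  moreover have "\<rho> (x, t) = (x, t)" if "(x, t) \<in> Y" "t = 0 \<or> N x = 1" for x t
    using that by (auto simp: \<rho>_def Y_def)
  ultimately have "retraction Y {y \<in> Y. snd y = 0 \<or> N (fst y) = 1} \<rho>"
    unfolding retraction_def by auto
  then show ?thesis
    unfolding retract_of_def by blast
qed

section \<open>A coordinate over one square transferred to another\<close>

definition far_point :: "nat \<Rightarrow> (nat \<Rightarrow> complex) \<Rightarrow> complex" where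
  "far_point n p = of_real (1 + (\<Sum>i<n. norm (p i)))"

lemma far_point_neq:
  assumes "i < n"
  shows "far_point n p \<noteq> p i"
proof -
  have "norm (p i) \<le> (\<Sum>i<n. norm (p i))"
    using assms by (intro member_le_sum) auto
  then have "norm (p i) < norm (far_point n p)"
    unfolding far_point_def norm_of_real by simp
  then show ?thesis by auto
qed

lemma continuous_on_far_point:
  assumes "\<And>i. i < n \<Longrightarrow> continuous_on S (P i)"
  shows "continuous_on S (\<lambda>x. far_point n (\<lambda>i. P i x))"
  unfolding far_point_def using assms by (intro continuous_intros) auto

abbreviation unit_square :: "(real \<times> real) set" where
  "unit_square \<equiv> {0..1} \<times> {0..1}"

definition square_rim :: "(real \<times> real) set" where
  "square_rim = {(t, s) \<in> unit_square. t \<in> {0, 1} \<or> s \<in> {0, 1}}"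

lemma retract_bottom_and_rim:
  "unit_square \<times> {0} \<union> square_rim \<times> {0..1} retract_of unit_square \<times> {0..1::real}"
proof -
  define N where "N = (\<lambda>z::real \<times> real. max \<bar>2 * fst z - 1\<bar> \<bar>2 * snd z - 1\<bar>)"
  have abs_eq: "\<bar>2 * x - 1\<bar> = 2 * \<bar>x - 1/2\<bar>" for x :: real
    by (simp add: abs_if)
  have homog: "N ((1/2, 1/2) + a *\<^sub>R (z - (1/2, 1/2))) = a * N z" if "a \<ge> 0" for a z
    using that unfolding N_def abs_eq by (simp add: abs_mult max_mult_distrib_left)
  have "continuous_on UNIV N"
    unfolding N_def by (intro continuous_intros)
  then have *: "{y \<in> {x. N x \<le> 1} \<times> {0..1}. snd y = 0 \<or> N (fst y) = 1}
      retract_of {x. N x \<le> 1} \<times> {0..1::real}"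
    by (rule retraction_onto_bottom_and_sides) (use homog in blast)
  have square: "{x. N x \<le> 1} = unit_square"
    by (auto simp: N_def)
  have rim: "{x. N x = 1} = square_rim"
    by (auto simp: N_def square_rim_def max_def split: if_splits)
  have "{y \<in> {x. N x \<le> 1} \<times> {0..1}. snd y = 0 \<or> N (fst y) = 1}
      = {x. N x \<le> 1} \<times> {0} \<union> {x. N x = 1} \<times> {0..1::real}"
    by auto
  then show ?thesis
    using * unfolding square rim by metis
qed

text \<open>
  In the coordinates \<open>((t, s), x)\<close> fix \<open>t\<close>: the square of the points \<open>(x, s)\<close> retracts onto its
  side \<open>s = 0\<close> together with the two sides \<open>x = 0\<close> and \<open>x = 1\<close>, which is the one-dimensional
  instance of the projection above.
\<close>
lemma retract_bottom_top_and_side: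
  "unit_square \<times> {0, 1} \<union> ({0..1} \<times> {0}) \<times> {0..1} retract_of unit_square \<times> {0..1::real}"
proof -
  define N where "N = (\<lambda>x::real. \<bar>2 * x - 1\<bar>)"
  have abs_eq: "\<bar>2 * x - 1\<bar> = 2 * \<bar>x - 1/2\<bar>" for x :: real
    by (simp add: abs_if)
  have homog: "N (1/2 + a *\<^sub>R (x - 1/2)) = a * N x" if "a \<ge> 0" for a x
    using that unfolding N_def abs_eq by (simp add: abs_mult)
  have "continuous_on UNIV N"
    unfolding N_def by (intro continuous_intros)
  then have *: "{y \<in> {x. N x \<le> 1} \<times> {0..1}. snd y = 0 \<or> N (fst y) = 1}
      retract_of {x. N x \<le> 1} \<times> {0..1::real}"
    by (rule retraction_onto_bottom_and_sides) (use homog in blast)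
  have interval: "{x. N x \<le> 1} = {0..1}"
    by (auto simp: N_def)
  have "{y \<in> {x. N x \<le> 1} \<times> {0..1}. snd y = 0 \<or> N (fst y) = 1}
      = {(x, s) \<in> unit_square. s = 0 \<or> x \<in> {0, 1}}"
    by (auto simp: N_def abs_if split: if_splits)
  with * have "{(x, s) \<in> unit_square. s = 0 \<or> x \<in> {0, 1}} retract_of unit_square"
    unfolding interval by metis
  then obtain \<rho> where retr: "retraction unit_square {(x, s) \<in> unit_square. s = 0 \<or> x \<in> {0, 1}} \<rho>"
    unfolding retract_of_def by blast
  note retr' = retr[unfolded retraction_def]
  have cont\<rho>: "continuous_on unit_square \<rho>"
    using retr' by (elim conjE)
  have \<rho>_in: "\<rho> \<in> unit_square \<rightarrow> {(x, s) \<in> unit_square. s = 0 \<or> x \<in> {0, 1}}"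
    using retr' by (elim conjE)
  have "\<forall>z\<in>{(x, s) \<in> unit_square. s = 0 \<or> x \<in> {0, 1}}. \<rho> z = z"
    using retr' by (elim conjE)
  then have \<rho>_fix: "\<rho> (x, s) = (x, s)" if "(x, s) \<in> unit_square" "s = 0 \<or> x \<in> {0, 1}" for x s
    using that by simp
  define R where "R = (\<lambda>((t, s), x). ((t::real, snd (\<rho> (x, s))), fst (\<rho> (x, s))))"
  have "continuous_on (unit_square \<times> {0..1}) R"
    unfolding R_def case_prod_unfold
    by (intro continuous_intros continuous_on_compose2[OF cont\<rho>]) auto
  moreover have R_in: "R ((t, s), x) \<in> unit_square \<times> {0, 1} \<union> ({0..1} \<times> {0}) \<times> {0..1}"
    if "t \<in> {0..1}" "s \<in> {0..1}" "x \<in> {0..1}" for t s x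
    using funcset_mem[OF \<rho>_in, of "(x, s)"] that by (auto simp: R_def mem_Times_iff)
  moreover have "R ((t, s), x) = ((t, s), x)"
    if "((t, s), x) \<in> unit_square \<times> {0, 1} \<union> ({0..1} \<times> {0}) \<times> {0..1}" for t s x
    using \<rho>_fix[of x s] that by (auto simp: R_def)
  moreover have "R \<in> unit_square \<times> {0..1} \<rightarrow> unit_square \<times> {0, 1} \<union> ({0..1} \<times> {0}) \<times> {0..1}"
  proof (rule funcsetI)
    fix y :: "(real \<times> real) \<times> real" assume "y \<in> unit_square \<times> {0..1}"
    then show "R y \<in> unit_square \<times> {0, 1} \<union> ({0..1} \<times> {0}) \<times> {0..1}"
      using R_in[of "fst (fst y)" "snd (fst y)" "snd y"] by (simp add: mem_Times_iff)
  qed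
  moreover have "unit_square \<times> {0, 1} \<union> ({0..1} \<times> {0}) \<times> {0..1} \<subseteq> unit_square \<times> {0..1::real}"
    by auto
  ultimately show ?thesis
    unfolding retract_of_def retraction_def by (intro exI[of _ R] conjI ballI) fastforce+
qed

text \<open>
  In both cubes the last coordinate is the time of the motion and the configuration underneath
  does not depend on it. The first cube lies over \<open>P\<close>: it joins the section (time 0) to \<open>k\<close>
  (time 1), and along the edge \<open>s = 0\<close>, where the configuration and \<open>k\<close> are constant, it follows a
  path in the plane minus \<open>n\<close> points. The second cube lies over \<open>H\<close>: it starts at the section and
  follows the first cube over the rim; its final face is the required coordinate.
\<close>
lemma relift_square:
  fixes P H :: "nat \<Rightarrow> real \<times> real \<Rightarrow> complex" and k :: "real \<times> real \<Rightarrow> complex"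
  assumes contP: "\<And>i. i < n \<Longrightarrow> continuous_on unit_square (P i)"
    and contH: "\<And>i. i < n \<Longrightarrow> continuous_on unit_square (H i)"
    and distP: "\<And>i j z. \<lbrakk>i < n; j < n; i \<noteq> j; z \<in> unit_square\<rbrakk> \<Longrightarrow> P i z \<noteq> P j z"
    and distH: "\<And>i j z. \<lbrakk>i < n; j < n; i \<noteq> j; z \<in> unit_square\<rbrakk> \<Longrightarrow> H i z \<noteq> H j z"
    and rim: "\<And>i z. \<lbrakk>i < n; z \<in> square_rim\<rbrakk> \<Longrightarrow> H i z = P i z"
    and start: "\<And>i t. \<lbrakk>i < n; t \<in> {0..1}\<rbrakk> \<Longrightarrow> P i (t, 0) = P i (0, 0)"
    and startk: "\<And>t. t \<in> {0..1} \<Longrightarrow> k (t, 0) = k (0, 0)"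
    and contk: "continuous_on unit_square k"
    and avoidk: "\<And>i z. \<lbrakk>i < n; z \<in> unit_square\<rbrakk> \<Longrightarrow> k z \<noteq> P i z"
  obtains h where "continuous_on unit_square h" "\<And>i z. \<lbrakk>i < n; z \<in> unit_square\<rbrakk> \<Longrightarrow> h z \<noteq> H i z"
    "\<And>z. z \<in> square_rim \<Longrightarrow> h z = k z"
proof -
  let ?Q = unit_square
  have compact: "compact (?Q \<times> {0..1::real})"
    by (intro compact_Times) auto
  have convex: "convex (?Q \<times> {0..1::real})"
    by (intro convex_Times) auto
  define SP where "SP = (\<lambda>z. far_point n (\<lambda>i. P i z))"
  define SH where "SH = (\<lambda>z. far_point n (\<lambda>i. H i z))"
  have contSP: "continuous_on ?Q SP" and contSH: "continuous_on ?Q SH"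
    unfolding SP_def SH_def by (intro continuous_on_far_point contP contH; assumption)+
  define p where "p = (\<lambda>i. P i (0, 0))"
  have SP0: "SP (t, 0) = far_point n p" if "t \<in> {0..1}" for t
    using start[OF _ that] by (simp add: SP_def p_def far_point_def)
  have "path_connected (- (p ` {..<n}))"
    by (intro path_connected_complement_countable) (auto intro: countable_finite)
  moreover have "far_point n p \<in> - (p ` {..<n})" "k (0, 0) \<in> - (p ` {..<n})"
    using far_point_neq[of _ n p] avoidk[of _ "(0, 0)"] by (auto simp: p_def)
  ultimately obtain a where a: "path a" "path_image a \<subseteq> - (p ` {..<n})"
    "pathstart a = far_point n p" "pathfinish a = k (0, 0)"
    unfolding path_connected_def by blast
  have avoida: "a x \<noteq> p i" if "i < n" "x \<in> {0..1}" for i x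
  proof -
    have "a x \<in> path_image a"
      using that by (simp add: path_image_def)
    then show ?thesis
      using a(2) that by blast
  qed

  define u where "u = (\<lambda>y. if snd y = 0 then SP (fst y) else if snd y = 1 then k (fst y) else a (snd y))"
  let ?B1 = "?Q \<times> {0, 1} \<union> ({0..1} \<times> {0}) \<times> {0..1::real}"
  have "a 0 = far_point n p" "a 1 = k (0, 0)"
    using a(3,4) by (simp_all add: pathstart_def pathfinish_def)
  then have u_simps: "u (z, 0) = SP z" "u (z, 1) = k z"
    "\<lbrakk>t \<in> {0..1}; x \<in> {0..1}\<rbrakk> \<Longrightarrow> u ((t, 0), x) = a x" for z t x
    using SP0[of t] startk[of t] by (simp_all add: u_def)
  have "continuous_on (?Q \<times> {0}) u"
    by (rule continuous_on_eq[where f="\<lambda>y. SP (fst y)"])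
       (auto intro!: continuous_on_compose2[OF contSP] continuous_intros simp: u_simps)
  moreover have "continuous_on (?Q \<times> {1}) u"
    by (rule continuous_on_eq[where f="\<lambda>y. k (fst y)"])
       (auto intro!: continuous_on_compose2[OF contk] continuous_intros simp: u_simps)
  moreover have "continuous_on (({0..1} \<times> {0}) \<times> {0..1}) u"
    by (rule continuous_on_eq[where f="\<lambda>y. a (snd y)"])
       (auto intro!: continuous_on_compose2[OF a(1)[unfolded path_def]] continuous_intros simp: u_simps)
  ultimately have "continuous_on (?Q \<times> {0} \<union> ?Q \<times> {1} \<union> ({0..1} \<times> {0}) \<times> {0..1}) u"
    by (intro continuous_on_closed_Un closed_Times closed_Un) auto
  moreover have "?Q \<times> {0} \<union> ?Q \<times> {1} \<union> ({0..1} \<times> {0}) \<times> {0..1} = ?B1"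
    by auto
  ultimately have contu: "continuous_on ?B1 u"
    by metis
  have avoidu: "u y \<noteq> P i (fst y)" if "i < n" "y \<in> ?B1" for i y
  proof -
    have "P i (t, 0) = p i" if "t \<in> {0..1}" for t
      unfolding p_def using \<open>i < n\<close> that by (rule start)
    moreover have "SP z \<noteq> P i z" for z
      unfolding SP_def using \<open>i < n\<close> by (rule far_point_neq)
    ultimately show ?thesis
      using that avoidk[OF \<open>i < n\<close>] avoida[OF \<open>i < n\<close>] by (auto simp: u_simps)
  qed
  obtain A where A: "continuous_on (?Q \<times> {0..1}) A"
    "\<And>i y. \<lbrakk>i < n; y \<in> ?Q \<times> {0..1}\<rbrakk> \<Longrightarrow> A y \<noteq> P i (fst y)"
    "\<And>y. y \<in> ?B1 \<Longrightarrow> A y = u y"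
  proof (rule extend_avoiding[OF compact convex retract_bottom_top_and_side, of n "\<lambda>i y. P i (fst y)" u])
    show "continuous_on (?Q \<times> {0..1}) (\<lambda>y. P i (fst y))" if "i < n" for i
      by (intro continuous_on_compose2[OF contP[OF that]] continuous_intros) auto
  qed (use contu avoidu distP in auto)

  \<comment> \<open>On the rim \<open>SH = SP\<close>, so the prescriptions on the bottom and on the sides of the second cube
    agree where they meet.\<close>
  define v where "v = (\<lambda>y. if snd y = 0 then SH (fst y) else A y)"
  let ?B2 = "?Q \<times> {0} \<union> square_rim \<times> {0..1::real}"
  have rimQ: "square_rim \<subseteq> ?Q"
    by (auto simp: square_rim_def)
  have SHrim: "SH z = SP z" if "z \<in> square_rim" for z
    using rim[OF _ that] by (simp add: SH_def SP_def far_point_def)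
  have v_simps: "\<And>z. v (z, 0) = SH z" "\<And>z x. z \<in> square_rim \<Longrightarrow> v (z, x) = A (z, x)"
    using A(3) rimQ by (auto simp: v_def SHrim u_simps)
  have "continuous_on (?Q \<times> {0}) v"
    by (rule continuous_on_eq[where f="\<lambda>y. SH (fst y)"])
       (auto intro!: continuous_on_compose2[OF contSH] continuous_intros simp: v_simps)
  moreover have "continuous_on (square_rim \<times> {0..1}) v"
    by (rule continuous_on_eq[where f=A])
       (use rimQ in \<open>auto intro!: continuous_on_subset[OF A(1)] simp: v_simps\<close>)
  moreover have "closed square_rim"
  proof -
    have "square_rim = {0..1} \<times> {0} \<union> {0..1} \<times> {1} \<union> {0} \<times> {0..1} \<union> {1} \<times> {0..1}"
      by (auto simp: square_rim_def)
    then show ?thesis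
      by (metis closed_Un closed_Times closed_singleton closed_atLeastAtMost)
  qed
  ultimately have contv: "continuous_on ?B2 v"
    by (intro continuous_on_closed_Un closed_Times) auto
  have avoidv: "v y \<noteq> H i (fst y)" if "i < n" "y \<in> ?B2" for i y
  proof -
    have "SH z \<noteq> H i z" for z
      unfolding SH_def using \<open>i < n\<close> by (rule far_point_neq)
    moreover have "A (z, x) \<noteq> H i z" if "z \<in> square_rim" "x \<in> {0..1}" for z x
      using A(2)[OF \<open>i < n\<close>, of "(z, x)"] rim[OF \<open>i < n\<close>] rimQ that by auto
    ultimately show ?thesis
      using that by (auto simp: v_simps)
  qed
  obtain E where E: "continuous_on (?Q \<times> {0..1}) E"
    "\<And>i y. \<lbrakk>i < n; y \<in> ?Q \<times> {0..1}\<rbrakk> \<Longrightarrow> E y \<noteq> H i (fst y)"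
    "\<And>y. y \<in> ?B2 \<Longrightarrow> E y = v y"
  proof (rule extend_avoiding[OF compact convex retract_bottom_and_rim, of n "\<lambda>i y. H i (fst y)" v])
    show "continuous_on (?Q \<times> {0..1}) (\<lambda>y. H i (fst y))" if "i < n" for i
      by (intro continuous_on_compose2[OF contH[OF that]] continuous_intros) auto
  qed (use contv avoidv distH in auto)
  show thesis
  proof (rule that[of "\<lambda>z. E (z, 1)"])
    show "continuous_on ?Q (\<lambda>z. E (z, 1))"
      by (intro continuous_on_compose2[OF E(1)] continuous_intros) auto
    show "E (z, 1) \<noteq> H i z" if "i < n" "z \<in> ?Q" for i z
      using E(2)[of i "(z, 1)"] that by simp
    show "E (z, 1) = k z" if "z \<in> square_rim" for z
    proof -
      have "z \<in> ?Q" using that rimQ by blast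
      have "E (z, 1) = A (z, 1)"
        using E(3)[of "(z, 1)"] that by (auto simp: v_simps)
      also have "\<dots> = k z"
        using A(3)[of "(z, 1)"] \<open>z \<in> ?Q\<close> by (auto simp: u_simps)
      finally show ?thesis .
    qed
  qed
qed

section \<open>Homotopies of paths as families of coordinates\<close>

lemma continuous_map_config_space:
  "continuous_map (top_of_set S) (config_space X) F \<longleftrightarrow>
     (\<forall>x\<in>X. continuous_on S (\<lambda>z. F z x)) \<and> (\<forall>z\<in>S. F z \<in> extensional X \<and> inj_on (F z) X)"
  unfolding config_space_def continuous_map_in_subtopology continuous_map_componentwise
  by (auto simp: Pi_iff image_subset_iff)

definition has_rim ::
    "(real \<Rightarrow> complex \<Rightarrow> complex) \<Rightarrow> (real \<Rightarrow> complex \<Rightarrow> complex) \<Rightarrow> complex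
      \<Rightarrow> (real \<times> real \<Rightarrow> complex) \<Rightarrow> bool" where
  "has_rim f g x r \<longleftrightarrow>
     (\<forall>s\<in>{0..1}. r (0, s) = f s x \<and> r (1, s) = g s x \<and> r (s, 0) = f 0 x \<and> r (s, 1) = f 1 x)"

lemma has_rim_unique:
  assumes "has_rim f g x r" "has_rim f g x r'" "z \<in> square_rim"
  shows "r z = r' z"
  using assms by (auto simp: has_rim_def square_rim_def)

lemma has_rim_cong:
  assumes "has_rim f g x r" "\<And>z. z \<in> square_rim \<Longrightarrow> r' z = r z"
  shows "has_rim f g x r'"
  using assms by (auto simp: has_rim_def square_rim_def)

text \<open>
  A homotopy in \<open>F\<^sub>X\<close> with the roles of points and coordinates exchanged. The parameter of the
  homotopy comes first in the square and the parameter of the paths second.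
\<close>
definition coordinate_homotopy ::
    "complex set \<Rightarrow> (real \<Rightarrow> complex \<Rightarrow> complex) \<Rightarrow> (real \<Rightarrow> complex \<Rightarrow> complex)
      \<Rightarrow> (complex \<Rightarrow> real \<times> real \<Rightarrow> complex) \<Rightarrow> bool" where
  "coordinate_homotopy X f g h \<longleftrightarrow>
     (\<forall>x\<in>X. continuous_on unit_square (h x) \<and> has_rim f g x (h x)) \<and>
     (\<forall>z\<in>unit_square. inj_on (\<lambda>x. h x z) X)"

lemma path_homotopic_config_space_iff:
  assumes ext: "\<And>s. s \<in> {0..1} \<Longrightarrow> f s \<in> extensional X \<and> g s \<in> extensional X"
  shows "path_homotopic (config_space X) f g \<longleftrightarrow> (\<exists>h. coordinate_homotopy X f g h)"
proof
  assume "path_homotopic (config_space X) f g"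
  then obtain \<kappa> where \<kappa>: "continuous_map (top_of_set unit_square) (config_space X) \<kappa>"
    "\<forall>s. \<kappa> (0, s) = f s" "\<forall>s. \<kappa> (1, s) = g s" "\<forall>t\<in>{0..1}. \<kappa> (t, 0) = f 0 \<and> \<kappa> (t, 1) = f 1"
    unfolding path_homotopic_def homotopic_with_def by auto
  then show "\<exists>h. coordinate_homotopy X f g h"
    by (intro exI[of _ "\<lambda>x z. \<kappa> z x"])
       (auto simp: coordinate_homotopy_def has_rim_def continuous_map_config_space)
next
  assume "\<exists>h. coordinate_homotopy X f g h"
  then obtain h where h: "coordinate_homotopy X f g h" ..
  define \<kappa> where "\<kappa> = (\<lambda>z. restrict (\<lambda>x. h x z) X)"
  have "continuous_map (top_of_set unit_square) (config_space X) \<kappa>"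
    using h by (auto simp: continuous_map_config_space \<kappa>_def coordinate_homotopy_def inj_on_def)
  moreover have "\<kappa> (0, s) = f s \<and> \<kappa> (1, s) = g s \<and> \<kappa> (s, 0) = f 0 \<and> \<kappa> (s, 1) = f 1" if "s \<in> {0..1}" for s
    using h ext[OF that] ext[of 0] ext[of 1] that
    by (auto simp: \<kappa>_def coordinate_homotopy_def has_rim_def intro!: extensionalityI[of _ X])
  ultimately show "path_homotopic (config_space X) f g"
    unfolding path_homotopic_def by (subst homotopic_with) auto
qed

text \<open>
  The condition on a candidate \<open>r\<close> for the coordinate \<open>h n\<close> once the earlier ones are chosen. It
  depends on \<open>h\<close> below \<open>n\<close> only, so that \<open>h\<close> can be defined by dependent choice.
\<close>
definition fits_above ::
    "(real \<Rightarrow> complex \<Rightarrow> complex) \<Rightarrow> (real \<Rightarrow> complex \<Rightarrow> complex)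
      \<Rightarrow> (nat \<Rightarrow> real \<times> real \<Rightarrow> complex) \<Rightarrow> nat \<Rightarrow> (real \<times> real \<Rightarrow> complex) \<Rightarrow> bool" where
  "fits_above f g h n r \<longleftrightarrow> continuous_on unit_square r \<and> has_rim f g (of_nat n) r \<and>
     (\<forall>i<n. \<forall>z\<in>unit_square. r z \<noteq> h i z)"

text \<open>
  The first \<open>n\<close> coordinates of \<open>K\<close> may differ from \<open>h\<close> inside the square, but they have the same
  rim, so that the last coordinate of \<open>K\<close> can be transferred from them to \<open>h\<close>.
\<close>
lemma fits_above_exists:
  assumes K: "coordinate_homotopy (initial_segment (Suc n)) f g K"
    and h: "\<And>i. i < n \<Longrightarrow> fits_above f g h i (h i)"
  shows "\<exists>r. fits_above f g h n r"
proof -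
  define P where "P = (\<lambda>i::nat. K (of_nat i))"
  have contP: "continuous_on unit_square (P i)" and rimP: "has_rim f g (of_nat i) (P i)" if "i < Suc n" for i
    using K that by (auto simp: coordinate_homotopy_def P_def initial_segment_def)
  have distP: "P i z \<noteq> P j z" if "i < Suc n" "j < Suc n" "i \<noteq> j" "z \<in> unit_square" for i j z
    using K that unfolding coordinate_homotopy_def P_def inj_on_def initial_segment_def
    by (metis imageI lessThan_iff of_nat_eq_iff)
  have start: "P i (t, 0) = P i (0, 0)" if "i < Suc n" "t \<in> {0..1}" for i t
    using rimP[OF that(1)] that(2) unfolding has_rim_def by (metis atLeastAtMost_iff order_refl zero_le_one)
  have conth: "continuous_on unit_square (h i)" and rimh: "has_rim f g (of_nat i) (h i)" if "i < n" for i
    using h[OF that] by (auto simp: fits_above_def)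
  have disth: "h i z \<noteq> h j z" if "i < n" "j < n" "i \<noteq> j" "z \<in> unit_square" for i j z
    using that(3)
  proof (cases i j rule: linorder_cases)
    case less
    then show ?thesis
      using h[OF \<open>j < n\<close>] \<open>z \<in> unit_square\<close> unfolding fits_above_def by metis
  next
    case greater
    then show ?thesis
      using h[OF \<open>i < n\<close>] \<open>z \<in> unit_square\<close> unfolding fits_above_def by metis
  qed simp
  have rim: "h i z = P i z" if "i < n" "z \<in> square_rim" for i z
    using has_rim_unique[OF rimh[OF that(1)] rimP[OF less_SucI[OF that(1)]] that(2)] .
  show ?thesis
  proof (rule relift_square[of n P h "P n"])
    fix r
    assume r: "continuous_on unit_square r" "\<And>i z. \<lbrakk>i < n; z \<in> unit_square\<rbrakk> \<Longrightarrow> r z \<noteq> h i z"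
      and "\<And>z. z \<in> square_rim \<Longrightarrow> r z = P n z"
    then have "has_rim f g (of_nat n) r"
      by (intro has_rim_cong[OF rimP[OF lessI]])
    then show "\<exists>r. fits_above f g h n r"
      using r unfolding fits_above_def by blast
  next
    show "continuous_on unit_square (P i)" if "i < n" for i
      using that by (intro contP) simp
    show "P i z \<noteq> P j z" if "i < n" "j < n" "i \<noteq> j" "z \<in> unit_square" for i j z
      using that by (intro distP) simp_all
    show "P n z \<noteq> P i z" if "i < n" "z \<in> unit_square" for i z
      using that by (intro distP) simp_all
    show "P i (t, 0) = P i (0, 0)" if "i < n" "t \<in> {0..1}" for i t
      using that by (intro start) simp_all
  qed (fact conth disth rim start[OF lessI] contP[OF lessI])+
qed

theorem theorem2p4:
  fixes f g :: "real \<Rightarrow> complex \<Rightarrow> complex"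
  assumes "is_braid omega f" and "is_braid omega g"
  shows "path_homotopic (config_space omega) f g \<longleftrightarrow>
         (\<forall>n. path_homotopic (config_space (initial_segment n))
                (path_restrict f (initial_segment n)) (path_restrict g (initial_segment n)))"
proof -
  have ext: "f s \<in> extensional omega \<and> g s \<in> extensional omega" if "s \<in> {0..1}" for s
    using assms that unfolding is_braid_def pathin_def continuous_map_config_space by auto
  have omega: "path_homotopic (config_space omega) f g \<longleftrightarrow> (\<exists>h. coordinate_homotopy omega f g h)"
    using ext by (rule path_homotopic_config_space_iff)
  have restr: "coordinate_homotopy X (path_restrict f X) (path_restrict g X) h \<longleftrightarrow> coordinate_homotopy X f g h" for X h
    by (auto simp: coordinate_homotopy_def has_rim_def path_restrict_def)
  have segment: "path_homotopic (config_space X) (path_restrict f X) (path_restrict g X)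
      \<longleftrightarrow> (\<exists>h. coordinate_homotopy X f g h)" for X
    using path_homotopic_config_space_iff[of "path_restrict f X" X "path_restrict g X"]
    unfolding restr by (simp add: path_restrict_def)
  have subset: "initial_segment n \<subseteq> omega" for n
    by (auto simp: initial_segment_def)
  show ?thesis
    unfolding omega segment
  proof (intro iffI allI)
    fix n assume "\<exists>h. coordinate_homotopy omega f g h"
    then show "\<exists>h. coordinate_homotopy (initial_segment n) f g h"
      using subset[of n] unfolding coordinate_homotopy_def by (meson inj_on_subset subsetD)
  next
    assume *: "\<forall>n. \<exists>h. coordinate_homotopy (initial_segment n) f g h"
    have "\<exists>h. \<forall>n. fits_above f g h n (h n)"
    proof (rule dependent_wellorder_choice[of "fits_above f g"])
      show "fits_above f g h n r = fits_above f g h' n r" if "\<And>i. i < n \<Longrightarrow> h i = h' i" for r h h' n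
        using that by (auto simp: fits_above_def)
      show "\<exists>r. fits_above f g h n r" if "\<And>i. i < n \<Longrightarrow> fits_above f g h i (h i)" for n h
        using * fits_above_exists that by metis
    qed
    then obtain h where h: "\<And>n. fits_above f g h n (h n)"
      by metis
    define k where "k = h \<circ> the_inv_into UNIV (of_nat :: nat \<Rightarrow> complex)"
    have k: "k (of_nat n) = h n" for n
      unfolding k_def by (simp add: the_inv_f_f inj_of_nat)
    have "inj_on (\<lambda>x. k x z) omega" if "z \<in> unit_square" for z
    proof (rule inj_onI)
      fix x y assume "x \<in> omega" "y \<in> omega" and eq: "k x z = k y z"
      then obtain m n where mn: "x = of_nat m" "y = of_nat n"
        by (auto elim!: Nats_cases)
      have "h m z \<noteq> h n z" if "m \<noteq> n" for m n
        using h[of m] h[of n] \<open>z \<in> unit_square\<close> that unfolding fits_above_def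
        by (metis linorder_neqE_nat)
      then show "x = y"
        using eq mn by (auto simp: k)
    qed
    moreover have "continuous_on unit_square (k x) \<and> has_rim f g x (k x)" if "x \<in> omega" for x
      using that h by (auto elim!: Nats_cases simp: k fits_above_def)
    ultimately show "\<exists>h. coordinate_homotopy omega f g h"
      unfolding coordinate_homotopy_def by blast
  qed
qed

end
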